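(* Let $X$ be an infinite locally compact Hausdorff space admitting a countable basis $\mathcal B$ of compact open sets closed under finite intersections, and let $W_0$ be the space of finite and infinite words in $X$. Let $d$ be the metric on $W_0$ given by $d(x,x)=0$ and, for $x\ne y$, $d(x,y)=2^{-i}$ where $i\in\mathbb N$ is the smallest index such that exactly one of $x,y$ belongs to $Z[p_i,\emptyset]$. Then $d$ is an ultrametric on $W_0$, i.e. $d(x,z)\le\max\{d(x,y),d(y,z)\}$ for all $x,y,z\in W_0$. Consequently, $W_0$ is an ultrametric space.
   Context: $\mathbb N=\{1,2,\dots\}$. $W_0=X^{\mathbb N}\cup\bigcup_{n\ge0}X^n$ with $X^0=\{\vec 0\}$ (empty word); elements are words $x=x_1x_2\cdots$ with length $\ell(x)\in\{0,1,2,\dots\}\cup\{\infty\}$. $\mathcal P=\bigcup_{n\ge1}\mathcal B^n$ is countable and $\mathcal P=\{p_1,p_2,\dots\}$ is a fixed enumeration; the element $(B_1,\dots,B_k)\in\mathcal B^k$ is written $B_1\times\cdots\times B_k$, and $Z[B_1\times\cdots\times B_k,\emptyset]=\{x\in W_0:\ell(x)\ge k,\ x_i\in B_i\text{ for }1\le i\le k\}$. *)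

theory Defs
  imports "HOL-Analysis.Analysis"
begin

(* Positions are counted from 0: the (i+1)-st letter of an infinite word is f i, and the
   empty word is Fin []. *)
datatype 'a word = Fin "'a list" | Inf "nat \<Rightarrow> 'a"

fun wlength :: "'a word \<Rightarrow> enat" where
  "wlength (Fin xs) = enat (length xs)"
| "wlength (Inf f) = \<infinity>"

(* Only meaningful for i < wlength x. *)
fun letter :: "'a word \<Rightarrow> nat \<Rightarrow> 'a" where
  "letter (Fin xs) i = xs ! i"
| "letter (Inf f) i = f i"

definition W0 :: "'a topology \<Rightarrow> 'a word set" where
  "W0 X = {Inf f | f. \<forall>i. f i \<in> topspace X} \<union> (\<Union>n. {Fin xs | xs. length xs = n \<and> set xs \<subseteq> topspace X})"

(* The union of the powers B^n, n \<ge> 1. Its elements are formal tuples, represented as lists of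
   sets, rather than the cartesian products they denote; the two differ if {} is in B. *)
definition base_tuples :: "'a set set \<Rightarrow> 'a set list set" where
  "base_tuples \<B> = (\<Union>n\<in>{1..}. {Bs. length Bs = n \<and> set Bs \<subseteq> \<B>})"

(* Z[B_1 x ... x B_k, {}] *)
definition Z :: "'a topology \<Rightarrow> 'a set list \<Rightarrow> 'a word set" where
  "Z X Bs = {x \<in> W0 X. enat (length Bs) \<le> wlength x \<and> (\<forall>i<length Bs. letter x i \<in> Bs ! i)}"

(* The value p 0 is never used: enumerations start at index 1. *)
definition separates :: "'a topology \<Rightarrow> (nat \<Rightarrow> 'a set list) \<Rightarrow> nat \<Rightarrow> 'a word \<Rightarrow> 'a word \<Rightarrow> bool" where
  "separates X p i x y \<longleftrightarrow> i \<ge> 1 \<and> (x \<in> Z X (p i)) \<noteq> (y \<in> Z X (p i))"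

(* LEAST is unspecified if no index separates x and y, so that positivity of this function on
   distinct words is not by itself evidence that the smallest separating index exists. *)
definition word_dist :: "'a topology \<Rightarrow> (nat \<Rightarrow> 'a set list) \<Rightarrow> 'a word \<Rightarrow> 'a word \<Rightarrow> real" where
  "word_dist X p x y = (if x = y then 0 else 1 / 2 ^ (LEAST i. separates X p i x y))"

locale Ultrametric_space = Metric_space +
  assumes ultrametric: "\<And>x y z. \<lbrakk>x \<in> M; y \<in> M; z \<in> M\<rbrakk> \<Longrightarrow> d x z \<le> max (d x y) (d y z)"

end

theory Submission
  imports Defs
begin

text \<open>
  If two words differ, then some finite prefix of one of them is not a prefix of the other, and
  choosing basic neighbourhoods of its letters that avoid the differing letters of the other word
  yields a separating set. The ultrametric inequality holds for every
  first-difference metric: a set separating \<open>x\<close> from \<open>z\<close> separates \<open>y\<close> from one of them.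
\<close>

lemma letter_in_topspace:
  assumes "x \<in> W0 X" "enat i < wlength x"
  shows "letter x i \<in> topspace X"
  using assms by (auto simp: W0_def)

lemma word_eqI:
  assumes len: "wlength x = wlength y"
    and letters: "\<And>i. enat i < wlength x \<Longrightarrow> letter x i = letter y i"
  shows "x = y"
  using assms by (cases x; cases y) (auto intro: nth_equalityI)

text \<open>The prefix is taken from the longer word \<open>y\<close> because a set
  \<open>Z X Bs\<close> containing a word of \<open>W0 X\<close> contains all its extensions in
  \<open>W0 X\<close>: if \<open>x\<close> is a proper prefix of \<open>y\<close>, only a set
  containing \<open>y\<close> can separate the two.\<close>

lemma obtain_distinguishing_prefix:
  assumes "x \<noteq> y" and le: "wlength x \<le> wlength y"
  obtains n where "n \<ge> 1" "enat n \<le> wlength y"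
    "enat n \<le> wlength x \<Longrightarrow> \<exists>i<n. letter x i \<noteq> letter y i"
proof (cases "\<exists>i. enat i < wlength x \<and> letter x i \<noteq> letter y i")
  case True
  then obtain i where i: "enat i < wlength x" "letter x i \<noteq> letter y i" by blast
  then have "enat (Suc i) \<le> wlength y"
    using le by (metis Suc_ile_eq order_less_le_trans)
  \<comment> \<open>Positions start at 0, so the prefix reaching position \<open>i\<close> has
    \<open>Suc i\<close> letters.\<close>
  with i show ?thesis by (intro that[of "Suc i"]) auto
next
  case False
  with \<open>x \<noteq> y\<close> word_eqI le have lt: "wlength x < wlength y"
    by (metis order_le_less)
  then obtain k where k: "wlength x = enat k" by (cases "wlength x") auto
  with lt have "enat (Suc k) \<le> wlength y" by (simp add: Suc_ile_eq)
  \<comment> \<open>Here \<open>x\<close> is a proper prefix of \<open>y\<close>; one letter more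
    than \<open>x\<close> has makes the premise of the last condition false.\<close>
  with k show ?thesis by (intro that[of "Suc k"]) auto
qed

text \<open>The point \<open>b\<close> may lie outside \<open>topspace X\<close>, where every open
  set avoids it. This matters because \<open>b\<close> will be a value of \<open>letter y i\<close>,
  which is unspecified beyond the end of \<open>y\<close>.\<close>

lemma t1_space_basis_separation:
  assumes "t1_space X" and "openin X = arbitrary union_of (\<lambda>U. U \<in> \<B>)" and "a \<in> topspace X"
  obtains B where "B \<in> \<B>" "a \<in> B" "b \<noteq> a \<Longrightarrow> b \<notin> B"
proof -
  obtain U where U: "openin X U" "a \<in> U" "b \<noteq> a \<Longrightarrow> b \<notin> U"
    using assms(1,3) unfolding t1_space_def by (metis openin_subset openin_topspace subsetD)
  then obtain B where "B \<in> \<B>" "a \<in> B" "B \<subseteq> U"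
    using assms(2) by (auto simp: union_of_def arbitrary_def)
  with U that show ?thesis by blast
qed

lemma base_tuple_separation:
  assumes t1: "t1_space X" and basis: "openin X = arbitrary union_of (\<lambda>U. U \<in> \<B>)"
    and x: "x \<in> W0 X" and n: "n \<ge> 1" "enat n \<le> wlength x"
    and diff: "enat n \<le> wlength y \<Longrightarrow> \<exists>i<n. letter y i \<noteq> letter x i"
  obtains Bs where "Bs \<in> base_tuples \<B>" "x \<in> Z X Bs" "y \<notin> Z X Bs"
proof -
  have "\<exists>B. B \<in> \<B> \<and> letter x i \<in> B \<and> (letter y i \<noteq> letter x i \<longrightarrow> letter y i \<notin> B)"
    if "i < n" for i
  proof -
    have "letter x i \<in> topspace X"
      using letter_in_topspace[OF x] that n(2) by (meson enat_ord_simps(2) order_less_le_trans)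
    then show ?thesis by (metis t1_space_basis_separation[OF t1 basis])
  qed
  then obtain B where B: "\<And>i. i < n \<Longrightarrow> B i \<in> \<B> \<and> letter x i \<in> B i
      \<and> (letter y i \<noteq> letter x i \<longrightarrow> letter y i \<notin> B i)"
    by metis
  show ?thesis
  proof (rule that[of "map B [0..<n]"])
    show "map B [0..<n] \<in> base_tuples \<B>"
      using n(1) B by (auto simp: base_tuples_def)
    show "x \<in> Z X (map B [0..<n])"
      using x n(2) B by (auto simp: Z_def)
    \<comment> \<open>Either \<open>y\<close> has fewer than \<open>n\<close> letters and fails the
      length condition in \<open>Z\<close>, or \<open>diff\<close> gives a position \<open>i\<close>
      at which its letter is outside \<open>B i\<close>.\<close>
    show "y \<notin> Z X (map B [0..<n])"
      using diff B by (fastforce simp: Z_def)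
  qed
qed

lemma separates_commute: "separates X p i x y \<longleftrightarrow> separates X p i y x"
  by (auto simp: separates_def)

lemma separates_exists:
  assumes t1: "t1_space X" and basis: "openin X = arbitrary union_of (\<lambda>U. U \<in> \<B>)"
    and p: "p ` {1..} = base_tuples \<B>"
    and "x \<in> W0 X" "y \<in> W0 X" "x \<noteq> y"
  shows "\<exists>i. separates X p i x y"
  using \<open>x \<in> W0 X\<close> \<open>y \<in> W0 X\<close> \<open>x \<noteq> y\<close>
\<comment> \<open>Separation is symmetric, so \<open>y\<close> may be assumed to be at least as long
  as \<open>x\<close>; the separating set is then built around \<open>y\<close>.\<close>
proof (induction "wlength x" "wlength y" arbitrary: x y rule: linorder_wlog)
  case (le x y)
  obtain n where "n \<ge> 1" "enat n \<le> wlength y"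
    "enat n \<le> wlength x \<Longrightarrow> \<exists>i<n. letter x i \<noteq> letter y i"
    using obtain_distinguishing_prefix le by metis
  then obtain Bs where Bs: "Bs \<in> base_tuples \<B>" "y \<in> Z X Bs" "x \<notin> Z X Bs"
    using base_tuple_separation[OF t1 basis \<open>y \<in> W0 X\<close>] by metis
  moreover obtain i where "i \<ge> 1" "p i = Bs"
    using p Bs(1) by (metis atLeast_iff imageE)
  ultimately show ?case by (auto simp: separates_def)
next
  case (sym x y)
  then show ?case by (metis separates_commute)
qed

lemma word_dist_nonneg: "0 \<le> word_dist X p x y"
  by (simp add: word_dist_def)

lemma word_dist_eq_0_iff: "word_dist X p x y = 0 \<longleftrightarrow> x = y"
  by (simp add: word_dist_def)

lemma word_dist_commute: "word_dist X p x y = word_dist X p y x"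
  by (simp add: word_dist_def separates_commute eq_commute)

lemma word_dist_ge:
  assumes "separates X p i x y"
  shows "1 / 2 ^ i \<le> word_dist X p x y"
proof -
  have "x \<noteq> y" using assms by (auto simp: separates_def)
  moreover have "(LEAST i. separates X p i x y) \<le> i"
    using assms by (rule Least_le)
  ultimately show ?thesis
    by (simp add: word_dist_def frac_le)
qed

text \<open>The assumption ensures that the \<open>LEAST\<close> defining the distance from
  \<open>x\<close> to \<open>z\<close> is attained. For the pair through \<open>y\<close> that is
  separated at this index, \<open>word_dist_ge\<close> bounds the distance from below.\<close>

lemma word_dist_ultrametric:
  assumes "x \<noteq> z \<Longrightarrow> \<exists>i. separates X p i x z"
  shows "word_dist X p x z \<le> max (word_dist X p x y) (word_dist X p y z)"
proof (cases "x = z")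
  case True
  then show ?thesis using word_dist_nonneg[of X p x y] by (simp add: word_dist_def)
next
  case False
  define m where "m = (LEAST i. separates X p i x z)"
  have "separates X p m x z"
    unfolding m_def using assms[OF False] by (rule LeastI_ex)
  \<comment> \<open>Whether or not \<open>y\<close> lies in \<open>Z X (p m)\<close>, its membership
    differs from that of exactly one of \<open>x\<close> and \<open>z\<close>.\<close>
  then have "separates X p m x y \<or> separates X p m y z"
    by (auto simp: separates_def)
  moreover have "word_dist X p x z = 1 / 2 ^ m"
    using False by (simp add: word_dist_def m_def)
  ultimately show ?thesis
    using word_dist_ge by (metis max.coboundedI1 max.coboundedI2)
qed

theorem proposition2p16:
  fixes X :: "'a topology" and \<B> :: "'a set set" and p :: "nat \<Rightarrow> 'a set list"
  assumes "infinite (topspace X)"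
    and "locally_compact_space X"
    and "Hausdorff_space X"
    and "countable \<B>"
    and "openin X = arbitrary union_of (\<lambda>U. U \<in> \<B>)"
    and "\<And>U. U \<in> \<B> \<Longrightarrow> openin X U \<and> compactin X U"
    and "\<And>\<F>. \<lbrakk>finite \<F>; \<F> \<noteq> {}; \<F> \<subseteq> \<B>\<rbrakk> \<Longrightarrow> \<Inter>\<F> \<in> \<B>"
    and "p ` {1..} = base_tuples \<B>"
  shows "(\<forall>x\<in>W0 X. \<forall>y\<in>W0 X. x \<noteq> y \<longrightarrow> (\<exists>i. separates X p i x y))
    \<and> (\<forall>x\<in>W0 X. \<forall>y\<in>W0 X. \<forall>z\<in>W0 X.
         word_dist X p x z \<le> max (word_dist X p x y) (word_dist X p y z))
    \<and> Ultrametric_space (W0 X) (word_dist X p)"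
proof -
  have sep: "\<exists>i. separates X p i x y" if "x \<in> W0 X" "y \<in> W0 X" "x \<noteq> y" for x y
    using separates_exists[OF Hausdorff_imp_t1_space[OF assms(3)] assms(5,8) that] .
  have ultra: "word_dist X p x z \<le> max (word_dist X p x y) (word_dist X p y z)"
    if "x \<in> W0 X" "z \<in> W0 X" for x y z
    using word_dist_ultrametric sep that by metis
  have "Ultrametric_space (W0 X) (word_dist X p)"
  proof
    fix x y z
    assume "x \<in> W0 X" "y \<in> W0 X" "z \<in> W0 X"
    then show "word_dist X p x z \<le> word_dist X p x y + word_dist X p y z"
      using ultra[of x z y] word_dist_nonneg[of X p x y] word_dist_nonneg[of X p y z] by linarith
  qed (use ultra in \<open>auto simp: word_dist_nonneg word_dist_eq_0_iff intro: word_dist_commute\<close>)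
  with sep ultra show ?thesis by blast
qed

end
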